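(* Let $n$ agents $[n]=\{1,\dots,n\}$ have strict preference lists, and run the sequential proposal algorithm described in the context. (1) The terminal directed partnerships form a permutation $\Pi$ of $[n]$ which satisfies the condition: for all $i,j\in[n]$, $$ i \text{ prefers } \Pi(j) \text{ to } \Pi(i)\ \Longrightarrow\ \Pi(j)\text{ prefers } j \text{ to } i. $$ (2) Call every permutation $\Pi$ of $[n]$ satisfying this condition stable. Then $\Pi$ is stable only if $\Pi^{-1}$ is stable. (3) Let $\Pi$ be the terminal permutation of an execution of the algorithm. For each agent $i$, the terminal successor $\Pi(i)$ is the best successor of $i$ in any stable permutation (i.e. the most preferred by $i$ among all $\Pi'(i)$, $\Pi'$ stable), and the terminal predecessor $\Pi^{-1}(i)$ is the worst predecessor of $i$ in any stable permutation (i.e. the least preferred by $i$ among all $(\Pi')^{-1}(i)$, $\Pi'$ stable). Consequently all possible executions of the proposal algorithm yield the same stable permutation $\Pi_0$, and it is such that each $i$ prefers $\Pi_0(i)$ to $\Pi_0^{-1}(i)$ (or $\Pi_0(i)=\Pi_0^{-1}(i)$). All pairs of agents matched in $\Pi_0$ (pairs $i\ne j$ with $\Pi_0(i)=j$, $\Pi_0(j)=i$) remain matched in all other stable permutations. Either the stable permutations are all fixed-point-free, or they share a single fixed point.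
   Context: Preferences: each agent $i\in[n]$ strictly ranks the other $n-1$ agents; the list is extended to length $n$ by putting in the last (least favored) slot the option "no partner", which is identified with $i$ itself (so $\Pi(i)=i$ means that $i$ has no partner, and $i$ prefers every other agent to $i$). "Prefers" is strict unless equality is explicitly allowed. Proposal algorithm: at every step there is a set $P$ of agents (predecessors), each being put on hold by (attached to) a single agent from an equinumerous set $S$ of agents (successors), distinct predecessors being held by distinct successors; an agent may be both a predecessor and a successor. There is also a set $U$ of unattached agents (agents not put on hold by anyone) who have not yet been rejected by all other agents. Initially nobody is on hold. As long as $U\ne\emptyset$, some unattached $u\in U$ (chosen in any order) proposes to its most preferred agent $v$ among the other agents that have not rejected $u$ earlier. If $v\notin S$ then $v$ accepts (puts $u$ on hold). If $v\in S$ and $v$ prefers $u$ to its current predecessor $w$, then $v$ accepts $u$ and rejects $w$, and $w$ joins $U$ if there remain agents who have not rejected $w$. Otherwise $v$ rejects $u$, and $u$ rejoins $U$ if there are still agents to whom $u$ has not proposed. The process terminates as soon as $U=\emptyset$. Terminal permutation: with $P_t$, $S_t$ the terminal predecessor and successor sets, set $\Pi(i)=v$ when $i\in P_t$ is held by $v\in S_t$ at termination; agents not in $P_t$ (those rejected by all others) are declared fixed points. $\Pi(i)$ is called the successor of $i$ and $\Pi^{-1}(i)$ the predecessor of $i$. *)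

theory Defs
  imports Main "HOL-Combinatorics.Permutations"
begin

definition preference_lists :: "nat \<Rightarrow> (nat \<Rightarrow> nat list) \<Rightarrow> bool" where
  "preference_lists n L \<longleftrightarrow>
     (\<forall>i\<in>{1..n}. distinct (L i) \<and> set (L i) = {1..n} - {i})"

text \<open>The list of \<open>i\<close>, most favored agent first, is extended by \<open>i\<close> itself, which stands for
  the option ``no partner''.\<close>

definition full_list :: "(nat \<Rightarrow> nat list) \<Rightarrow> nat \<Rightarrow> nat list" where
  "full_list L i = L i @ [i]"

definition prefers :: "(nat \<Rightarrow> nat list) \<Rightarrow> nat \<Rightarrow> nat \<Rightarrow> nat \<Rightarrow> bool" where
  "prefers L i a b \<longleftrightarrow>
     (\<exists>k l. k < l \<and> l < length (full_list L i) \<and> full_list L i ! k = a \<and> full_list L i ! l = b)"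

definition most_preferred :: "(nat \<Rightarrow> nat list) \<Rightarrow> nat \<Rightarrow> nat set \<Rightarrow> nat \<Rightarrow> bool" where
  "most_preferred L i A x \<longleftrightarrow> x \<in> A \<and> (\<forall>y\<in>A. y \<noteq> x \<longrightarrow> prefers L i x y)"

definition least_preferred :: "(nat \<Rightarrow> nat list) \<Rightarrow> nat \<Rightarrow> nat set \<Rightarrow> nat \<Rightarrow> bool" where
  "least_preferred L i A x \<longleftrightarrow> x \<in> A \<and> (\<forall>y\<in>A. y \<noteq> x \<longrightarrow> prefers L i y x)"

text \<open>\<open>hold s u = Some v\<close>: the predecessor \<open>u\<close> is put on hold by the successor \<open>v\<close>.
  \<open>(u, v) \<in> rejected s\<close>: the agent \<open>u\<close> has been rejected by \<open>v\<close>.\<close>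

record state =
  hold :: "nat \<Rightarrow> nat option"
  rejected :: "(nat \<times> nat) set"

definition predecessors :: "state \<Rightarrow> nat set" where
  "predecessors s = dom (hold s)"

definition successors :: "state \<Rightarrow> nat set" where
  "successors s = ran (hold s)"

definition remaining :: "nat \<Rightarrow> state \<Rightarrow> nat \<Rightarrow> nat set" where
  "remaining n s u = {v \<in> {1..n}. v \<noteq> u \<and> (u, v) \<notin> rejected s}"

text \<open>The set \<open>U\<close>. It is determined by the rest of the state, so agents join and leave it
  without explicit bookkeeping. The agents an unattached \<open>u\<close> has proposed to are exactly those
  that have rejected \<open>u\<close>.\<close>

definition unattached :: "nat \<Rightarrow> state \<Rightarrow> nat set" where
  "unattached n s = {u \<in> {1..n}. u \<notin> predecessors s \<and> remaining n s u \<noteq> {}}"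

definition initial_state :: state where
  "initial_state = \<lparr>hold = Map.empty, rejected = {}\<rparr>"

inductive proposal_step :: "nat \<Rightarrow> (nat \<Rightarrow> nat list) \<Rightarrow> state \<Rightarrow> state \<Rightarrow> bool"
  for n :: nat and L :: "nat \<Rightarrow> nat list" where
  accept:
    "\<lbrakk>u \<in> unattached n s; most_preferred L u (remaining n s u) v; v \<notin> successors s\<rbrakk>
     \<Longrightarrow> proposal_step n L s (s\<lparr>hold := (hold s)(u \<mapsto> v)\<rparr>)"
| exchange:
    "\<lbrakk>u \<in> unattached n s; most_preferred L u (remaining n s u) v;
      hold s w = Some v; prefers L v u w\<rbrakk>
     \<Longrightarrow> proposal_step n L s
          (s\<lparr>hold := (hold s)(w := None, u \<mapsto> v), rejected := insert (w, v) (rejected s)\<rparr>)"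
| reject:
    "\<lbrakk>u \<in> unattached n s; most_preferred L u (remaining n s u) v;
      hold s w = Some v; \<not> prefers L v u w\<rbrakk>
     \<Longrightarrow> proposal_step n L s (s\<lparr>rejected := insert (u, v) (rejected s)\<rparr>)"

definition successor_map :: "state \<Rightarrow> nat \<Rightarrow> nat" where
  "successor_map s i = (case hold s i of Some v \<Rightarrow> v | None \<Rightarrow> i)"

text \<open>\<open>\<pi>\<close> is the result of some execution that has terminated. That it is a permutation of the
  agents is not part of the definition.\<close>

definition execution_result :: "nat \<Rightarrow> (nat \<Rightarrow> nat list) \<Rightarrow> (nat \<Rightarrow> nat) \<Rightarrow> bool" where
  "execution_result n L \<pi> \<longleftrightarrow>
     (\<exists>s. (proposal_step n L)\<^sup>*\<^sup>* initial_state s \<and> unattached n s = {} \<and> \<pi> = successor_map s)"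

definition infinite_execution :: "nat \<Rightarrow> (nat \<Rightarrow> nat list) \<Rightarrow> (nat \<Rightarrow> state) \<Rightarrow> bool" where
  "infinite_execution n L \<sigma> \<longleftrightarrow>
     \<sigma> 0 = initial_state \<and> (\<forall>k. proposal_step n L (\<sigma> k) (\<sigma> (Suc k)))"

definition stable_permutation :: "nat \<Rightarrow> (nat \<Rightarrow> nat list) \<Rightarrow> (nat \<Rightarrow> nat) \<Rightarrow> bool" where
  "stable_permutation n L \<pi> \<longleftrightarrow>
     \<pi> permutes {1..n} \<and>
     (\<forall>i\<in>{1..n}. \<forall>j\<in>{1..n}.
        prefers L i (\<pi> j) (\<pi> i) \<longrightarrow> prefers L (\<pi> j) j i)"

end

theory Submission
  imports Defs
begin

text \<open>No agent is ever rejected by its successor in a stable permutation \<open>\<pi>\<close>: if \<open>v\<close> were the first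
  to do so, rejecting \<open>u\<close> with \<open>\<pi> u = v\<close> in favour of \<open>w\<close>, then \<open>w\<close> has been rejected by every agent
  it prefers to \<open>v\<close>, hence prefers \<open>v = \<pi> u\<close> to \<open>\<pi> w\<close>, while \<open>v\<close> prefers \<open>w\<close> to \<open>u\<close>, against
  stability. So every execution gives each agent its best stable successor, and the remaining
  claims follow by comparing with the inverse of a stable permutation, which is again stable.\<close>

locale preferences =
  fixes n :: nat and L :: "nat \<Rightarrow> nat list"
  assumes lists: "preference_lists n L"
begin

section \<open>The strict linear order given by a preference list\<close>

lemma distinct_full_list: "i \<in> {1..n} \<Longrightarrow> distinct (full_list L i)"
  and set_full_list: "i \<in> {1..n} \<Longrightarrow> set (full_list L i) = {1..n}"
  using lists by (auto simp: preference_lists_def full_list_def)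

lemma prefers_not_self: "i \<in> {1..n} \<Longrightarrow> prefers L i a b \<Longrightarrow> a \<noteq> i"
proof
  assume i: "i \<in> {1..n}" and p: "prefers L i a b" and "a = i"
  then obtain k l where kl: "k < l" "l < length (full_list L i)" "full_list L i ! k = i"
    by (auto simp: prefers_def)
  \<comment> \<open>The agent \<open>i\<close> stands at the last index,
    \<open>length (L i)\<close>; by distinctness this is its only index, whereas \<open>k\<close>
    lies below another valid index \<open>l\<close>.\<close>
  then have "full_list L i ! (length (L i)) = full_list L i ! k"
    by (simp add: full_list_def)
  then have "length (L i) = k"
    using kl distinct_full_list[OF i] by (subst (asm) nth_eq_iff_index_eq) (auto simp: full_list_def)
  then show False using kl by (simp add: full_list_def)
qed

lemma prefers_total:
  assumes "i \<in> {1..n}" "a \<in> {1..n}" "b \<in> {1..n}" "a \<noteq> b"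
  shows "prefers L i a b \<or> prefers L i b a"
proof -
  obtain k l where "k < length (full_list L i)" "full_list L i ! k = a"
    "l < length (full_list L i)" "full_list L i ! l = b"
    using assms set_full_list[of i] by (metis in_set_conv_nth)
  moreover from this assms(4) have "k < l \<or> l < k" by (metis nat_neq_iff)
  ultimately show ?thesis unfolding prefers_def by blast
qed

lemma prefers_self: "i \<in> {1..n} \<Longrightarrow> a \<in> {1..n} \<Longrightarrow> a \<noteq> i \<Longrightarrow> prefers L i a i"
  using prefers_total prefers_not_self by blast

lemma prefers_in: "i \<in> {1..n} \<Longrightarrow> prefers L i a b \<Longrightarrow> a \<in> {1..n} \<and> b \<in> {1..n}"
  using set_full_list[of i] nth_mem[of _ "full_list L i"] unfolding prefers_def by fastforce

lemma prefers_trans: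
  assumes "i \<in> {1..n}" "prefers L i a b" "prefers L i b c"
  shows "prefers L i a c"
proof -
  from assms(2) obtain k l where kl: "k < l" "l < length (full_list L i)"
    "full_list L i ! k = a" "full_list L i ! l = b" by (auto simp: prefers_def)
  from assms(3) obtain k' l' where kl': "k' < l'" "l' < length (full_list L i)"
    "full_list L i ! k' = b" "full_list L i ! l' = c" by (auto simp: prefers_def)
  have "l = k'"
    using distinct_full_list[OF assms(1)] kl kl' nth_eq_iff_index_eq[of "full_list L i" l k'] by auto
  then have "k < l'" using kl kl' by simp
  then show ?thesis using kl kl' unfolding prefers_def by blast
qed

lemma prefers_asym:
  assumes i: "i \<in> {1..n}" and p: "prefers L i a b"
  shows "\<not> prefers L i b a"
proof
  assume "prefers L i b a"
  then have "prefers L i a a" using prefers_trans[OF i p] by blast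
  then show False
    using distinct_full_list[OF i] by (auto simp: prefers_def nth_eq_iff_index_eq)
qed

lemma most_preferred_exists:
  assumes i: "i \<in> {1..n}" and A: "A \<subseteq> {1..n}" "A \<noteq> {}"
  shows "\<exists>x. most_preferred L i A x"
proof -
  have "finite A" using A finite_subset by blast
  from this A(2,1) show ?thesis
  proof (induction rule: finite_ne_induct)
    case (singleton x)
    then show ?case by (auto simp: most_preferred_def)
  next
    case (insert y A)
    then obtain x where x: "most_preferred L i A x" by auto
    then have xy: "prefers L i x y \<or> prefers L i y x"
      using insert prefers_total[OF i, of x y] unfolding most_preferred_def by blast
    from xy show ?case
    proof
      assume "prefers L i x y"
      then show ?thesis using x by (auto simp: most_preferred_def)
    next
      assume "prefers L i y x"
      then have "most_preferred L i (insert y A) y"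
        using x prefers_trans[OF i, of y x] by (auto simp: most_preferred_def)
      then show ?thesis ..
    qed
  qed
qed

section \<open>The invariant of the proposal algorithm\<close>

text \<open>By the first clause a held agent has been rejected by everyone it prefers to its holder.
  The last clause expresses that successors only trade up: a rejection by \<open>v\<close> is
  witnessed by the agent \<open>v\<close> holds now, not merely by the one held when it
  occurred.\<close>

definition consistent :: "state \<Rightarrow> bool" where
  "consistent s \<longleftrightarrow>
     (\<forall>u v. hold s u = Some v \<longrightarrow> u \<in> {1..n} \<and> most_preferred L u (remaining n s u) v) \<and>
     (\<forall>u w v. hold s u = Some v \<longrightarrow> hold s w = Some v \<longrightarrow> u = w) \<and>
     (\<forall>u v. (u, v) \<in> rejected s \<longrightarrow>
        u \<in> {1..n} \<and> v \<in> {1..n} \<and> (\<exists>w. hold s w = Some v \<and> prefers L v w u))"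

lemma consistentI:
  assumes "\<And>u v. hold s u = Some v \<Longrightarrow> u \<in> {1..n}"
    and "\<And>u v. hold s u = Some v \<Longrightarrow> most_preferred L u (remaining n s u) v"
    and "\<And>u w v. hold s u = Some v \<Longrightarrow> hold s w = Some v \<Longrightarrow> u = w"
    and "\<And>u v. (u, v) \<in> rejected s \<Longrightarrow> u \<in> {1..n}"
    and "\<And>u v. (u, v) \<in> rejected s \<Longrightarrow> v \<in> {1..n}"
    and "\<And>u v. (u, v) \<in> rejected s \<Longrightarrow> \<exists>w. hold s w = Some v \<and> prefers L v w u"
  shows "consistent s"
  unfolding consistent_def using assms by blast

lemma consistentD:
  assumes "consistent s"
  shows "hold s u = Some v \<Longrightarrow> u \<in> {1..n}"
    and "hold s u = Some v \<Longrightarrow> most_preferred L u (remaining n s u) v"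
    and "hold s u = Some v \<Longrightarrow> hold s w = Some v \<Longrightarrow> u = w"
    and "(u, v) \<in> rejected s \<Longrightarrow> u \<in> {1..n}"
    and "(u, v) \<in> rejected s \<Longrightarrow> v \<in> {1..n}"
    and "(u, v) \<in> rejected s \<Longrightarrow> \<exists>w. hold s w = Some v \<and> prefers L v w u"
  using assms unfolding consistent_def by blast+

lemma consistent_initial: "consistent initial_state"
  by (auto simp: consistent_def initial_state_def)

lemma remainingD:
  "most_preferred L u (remaining n s u) v \<Longrightarrow> v \<in> {1..n} \<and> v \<noteq> u \<and> (u, v) \<notin> rejected s"
  by (auto simp: most_preferred_def remaining_def)

lemma unattachedD: "u \<in> unattached n s \<Longrightarrow> u \<in> {1..n} \<and> hold s u = None"
  by (auto simp: unattached_def predecessors_def)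

lemma remaining_hold_update [simp]: "remaining n (s\<lparr>hold := h\<rparr>) u = remaining n s u"
  by (simp add: remaining_def)

text \<open>Proposals go to the top remaining agent, and a new rejection only shrinks the options of
  an agent left unheld, so held agents stay with their top choice. An exchange improves the agent
  held, so older rejections keep a witness.\<close>

lemma consistent_step:
  assumes "proposal_step n L s s'" "consistent s"
  shows "consistent s'"
  using assms
proof (induction rule: proposal_step.induct)
  case (accept u s v)
  note u = unattachedD[OF accept(1)] and c = consistentD[OF accept(4)]
  let ?h = "(hold s)(u \<mapsto> v)"
  have fresh: "hold s w \<noteq> Some v" for w
    using accept(3) by (auto simp: successors_def ran_def)
  have cases: "x = u \<and> y = v \<or> x \<noteq> u \<and> hold s x = Some y" if "?h x = Some y" for x y
    using that by (auto split: if_splits)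
  show ?case
  proof (rule consistentI)
    fix x y assume "hold (s\<lparr>hold := ?h\<rparr>) x = Some y"
    then have xy: "?h x = Some y" by simp
    show "x \<in> {1..n}" using cases[OF xy] u c(1) by blast
    show "most_preferred L x (remaining n (s\<lparr>hold := ?h\<rparr>) x) y"
      unfolding remaining_hold_update using cases[OF xy] accept(2) c(2) by blast
    fix z assume "hold (s\<lparr>hold := ?h\<rparr>) z = Some y"
    then have "?h z = Some y" by simp
    from cases[OF xy] cases[OF this] show "x = z" using fresh c(3) by blast
  next
    fix x y assume "(x, y) \<in> rejected (s\<lparr>hold := ?h\<rparr>)"
    then have xy: "(x, y) \<in> rejected s" by simp
    show "x \<in> {1..n}" "y \<in> {1..n}" using c(4,5)[OF xy] by auto
    obtain z where "hold s z = Some y" "prefers L y z x" using c(6)[OF xy] by blast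
    then show "\<exists>z. hold (s\<lparr>hold := ?h\<rparr>) z = Some y \<and> prefers L y z x"
      using u by (intro exI[of _ z]) auto
  qed
next
  case (exchange u s v w)
  note u = unattachedD[OF exchange(1)] and c = consistentD[OF exchange(5)]
  let ?h = "(hold s)(w := None, u \<mapsto> v)"
  let ?s = "s\<lparr>hold := ?h, rejected := insert (w, v) (rejected s)\<rparr>"
  have uw: "u \<noteq> w" using u exchange(3) by auto
  have w: "w \<in> {1..n}" using c(1) exchange(3) by blast
  have v: "v \<in> {1..n}" using remainingD[OF exchange(2)] by blast
  have rem: "remaining n ?s x = remaining n s x" if "x \<noteq> w" for x
    using that by (simp add: remaining_def)
  have cases: "x = u \<and> y = v \<or> x \<noteq> u \<and> x \<noteq> w \<and> hold s x = Some y" if "?h x = Some y" for x y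
    using that by (auto split: if_splits)
  have mono: "\<exists>z. ?h z = Some y \<and> prefers L y z x" if xy: "(x, y) \<in> rejected s" for x y
  proof -
    obtain z where z: "hold s z = Some y" "prefers L y z x" using c(6)[OF xy] by blast
    \<comment> \<open>The old witness may be the ousted \<open>w\<close>; then \<open>u\<close>,
      ranked even higher by \<open>v\<close>, takes over by transitivity.\<close>
    show ?thesis
    proof (cases "z = w")
      case True
      then have "y = v" using z exchange(3) by simp
      then have "prefers L y u x" using True z exchange(4) prefers_trans[OF v] by blast
      then show ?thesis using \<open>y = v\<close> by (intro exI[of _ u]) simp
    next
      case False
      then show ?thesis using z u by (intro exI[of _ z]) auto
    qed
  qed
  show ?case
  proof (rule consistentI)
    fix x y assume "hold ?s x = Some y"
    then have xy: "?h x = Some y" by simp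
    show "x \<in> {1..n}" using cases[OF xy] u c(1) by blast
    show "most_preferred L x (remaining n ?s x) y"
      using cases[OF xy] exchange(2) c(2)[of x y] uw rem[of x] by metis
    fix z assume "hold ?s z = Some y"
    then have "?h z = Some y" by simp
    from cases[OF xy] cases[OF this] show "x = z" using exchange(3) c(3) by blast
  next
    fix x y assume "(x, y) \<in> rejected ?s"
    then have xy: "x = w \<and> y = v \<or> (x, y) \<in> rejected s" by auto
    then show "x \<in> {1..n}" "y \<in> {1..n}" using w v c(4,5) by blast+
    have "?h u = Some v" by simp
    then have "\<exists>z. ?h z = Some y \<and> prefers L y z x" using xy mono exchange(4) by blast
    then show "\<exists>z. hold ?s z = Some y \<and> prefers L y z x" by simp
  qed
next
  case (reject u s v w)
  note u = unattachedD[OF reject(1)] and c = consistentD[OF reject(5)]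
  let ?s = "s\<lparr>rejected := insert (u, v) (rejected s)\<rparr>"
  have uw: "u \<noteq> w" using u reject(3) by auto
  have w: "w \<in> {1..n}" using c(1) reject(3) by blast
  have v: "v \<in> {1..n}" using remainingD[OF reject(2)] by blast
  \<comment> \<open>The rule only denies a preference for \<open>u\<close>; as \<open>u\<close> and
    \<open>w\<close> differ, totality turns this into a strict preference for
    \<open>w\<close>.\<close>
  have worse: "prefers L v w u" using prefers_total[OF v _ w uw] u reject(4) by blast
  have rem: "remaining n ?s x = remaining n s x" if "x \<noteq> u" for x
    using that by (simp add: remaining_def)
  show ?case
  proof (rule consistentI)
    fix x y assume "hold ?s x = Some y"
    then have xy: "hold s x = Some y" by simp
    then have "x \<noteq> u" using u by auto
    then show "most_preferred L x (remaining n ?s x) y" using c(2)[OF xy] rem by simp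
    show "x \<in> {1..n}" using c(1)[OF xy] .
    fix z assume "hold ?s z = Some y"
    then show "x = z" using c(3)[OF xy] by simp
  next
    fix x y assume "(x, y) \<in> rejected ?s"
    then have xy: "x = u \<and> y = v \<or> (x, y) \<in> rejected s" by auto
    then show "x \<in> {1..n}" "y \<in> {1..n}" using u v c(4,5) by blast+
    have "\<exists>z. hold s z = Some y \<and> prefers L y z x" using xy c(6) reject(3) worse by blast
    then show "\<exists>z. hold ?s z = Some y \<and> prefers L y z x" by simp
  qed
qed

lemma consistent_reachable:
  "(proposal_step n L)\<^sup>*\<^sup>* initial_state s \<Longrightarrow> consistent s"
  by (induction rule: rtranclp_induct) (auto intro: consistent_initial consistent_step)

section \<open>Rejections and the terminal state\<close>

lemma stable_in: "stable_permutation n L \<pi> \<Longrightarrow> i \<in> {1..n} \<Longrightarrow> \<pi> i \<in> {1..n}"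
  by (simp only: stable_permutation_def permutes_in_image)

text \<open>Since \<open>remaining\<close> leaves out \<open>u\<close> itself, the option of having
  no partner is treated separately: being last on the list, it loses to \<open>v\<close>.\<close>

lemma prefers_top:
  assumes u: "u \<in> {1..n}" and top: "most_preferred L u (remaining n s u) v"
    and x: "x \<in> {1..n}" "x \<noteq> v" "(u, x) \<notin> rejected s"
  shows "prefers L u v x"
proof (cases "x = u")
  case True
  then show ?thesis using prefers_self[OF u] remainingD[OF top] by blast
next
  case False
  then have "x \<in> remaining n s u" using x by (simp add: remaining_def)
  then show ?thesis using top x(2) by (simp add: most_preferred_def)
qed

text \<open>Of the favoured agent \<open>w\<close> only \<open>top\<close> is asked, not that
  \<open>v\<close> holds it, so both a newcomer ousting \<open>u\<close> and a held agent against
  whom the proposer \<open>u\<close> loses are covered.\<close>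

lemma no_stable_rejection:
  assumes st: "stable_permutation n L \<pi>"
    and vw: "v \<in> {1..n}" "w \<in> {1..n}" "u \<in> {1..n}"
    and top: "most_preferred L w (remaining n s w) v"
    and safe: "(w, \<pi> w) \<notin> rejected s"
    and worse: "prefers L v w u"
  shows "\<pi> u \<noteq> v"
proof
  assume eq: "\<pi> u = v"
  have "u \<noteq> w" using worse prefers_asym vw(1) by blast
  moreover have "inj \<pi>" using st by (auto simp: stable_permutation_def permutes_inj)
  ultimately have "\<pi> w \<noteq> v" using eq by (auto dest: injD)
  then have "prefers L w (\<pi> u) (\<pi> w)"
    using prefers_top[OF vw(2) top] stable_in[OF st vw(2)] safe eq by blast
  then have "prefers L v u w" using st vw eq unfolding stable_permutation_def by blast
  then show False using worse prefers_asym vw(1) by blast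
qed

text \<open>Induction along the execution with \<open>u\<close> and \<open>v\<close> arbitrary: the
  hypothesis on the state before the step yields the premise \<open>safe\<close> of
  \<open>no_stable_rejection\<close> for the favoured agent.\<close>

lemma rejected_not_stable_successor:
  assumes "(proposal_step n L)\<^sup>*\<^sup>* initial_state s" "stable_permutation n L \<pi>"
  shows "(u, v) \<in> rejected s \<Longrightarrow> \<pi> u \<noteq> v"
  using assms(1)
proof (induction arbitrary: u v rule: rtranclp_induct)
  case base
  then show ?case by (simp add: initial_state_def)
next
  case (step s s')
  note c = consistent_reachable[OF step(1), unfolded consistent_def]
  from step(2) show ?case
  proof cases
    case (accept u' v')
    then show ?thesis using step by simp
  next
    case (exchange x y w)
    have y: "y \<in> {1..n}" using remainingD[OF exchange(3)] by blast
    \<comment> \<open>The favoured agent is the newcomer \<open>x\<close>, whose top choice is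
      \<open>y\<close> because it proposes there.\<close>
    have "\<pi> w \<noteq> y"
      using no_stable_rejection[OF assms(2) y _ _ exchange(3) _ exchange(5)]
        unattachedD[OF exchange(2)] c exchange(4) step(3) by blast
    then show ?thesis using exchange(1) step(3,4) by auto
  next
    case (reject x y w)
    have y: "y \<in> {1..n}" using remainingD[OF reject(3)] by blast
    \<comment> \<open>Now the agent \<open>w\<close> already held is the favoured one; that
      \<open>y\<close> is its top choice comes from the invariant.\<close>
    have w: "w \<in> {1..n}" "most_preferred L w (remaining n s w) y" using c reject(4) by blast+
    have x: "x \<in> {1..n}" "x \<noteq> w" using unattachedD[OF reject(2)] reject(4) by auto
    have "prefers L y w x" using prefers_total[OF y x(1) w(1) x(2)] reject(5) by blast
    then have "\<pi> x \<noteq> y"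
      using no_stable_rejection[OF assms(2) y w(1) x(1) w(2)] step(3) by blast
    then show ?thesis using reject(1) step(3,4) by auto
  qed
qed

text \<open>An agent \<open>u\<close> rejected by all others is nobody's successor: every other agent is one, since
  whoever rejects holds somebody, and there are at most \<open>n - 1\<close> predecessors.\<close>

lemma terminal_permutes:
  assumes c: "consistent s" and t: "unattached n s = {}"
  shows "successor_map s permutes {1..n}"
proof -
  note c' = c[unfolded consistent_def]
  have held: "u \<in> {1..n}" "v \<in> {1..n}" "v \<noteq> u" if "hold s u = Some v" for u v
    using c' that remainingD by blast+
  have unheld: "\<exists>w. hold s w = Some v" if "u \<in> {1..n}" "hold s u = None" "v \<in> {1..n}" "v \<noteq> u" for u v
  proof -
    have "v \<notin> remaining n s u" using t that by (auto simp: unattached_def predecessors_def dom_def)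
    then have "(u, v) \<in> rejected s" using that by (simp add: remaining_def)
    then show ?thesis using c' by blast
  qed
  have free: "hold s w \<noteq> Some u" if u: "u \<in> {1..n}" "hold s u = None" for u w
  proof
    assume w: "hold s w = Some u"
    have sub: "{1..n} \<subseteq> ran (hold s)"
      using unheld[OF u] w by (auto simp: ran_def) metis
    have "dom (hold s) \<subseteq> {1..n} - {u}" using held u by auto
    then have fin: "finite (dom (hold s))" "card (dom (hold s)) \<le> card ({1..n} - {u})"
      by (auto intro: finite_subset card_mono)
    have "ran (hold s) = (\<lambda>x. the (hold s x)) ` dom (hold s)"
      by (force simp: ran_def dom_def)
    then have "finite (ran (hold s))" "card (ran (hold s)) \<le> card (dom (hold s))"
      using fin(1) by (simp_all add: card_image_le)
    then have "card {1..n} \<le> card (dom (hold s))"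
      using sub card_mono le_trans by blast
    moreover have "card ({1..n} - {u}) < card {1..n}"
      using u(1) by (intro card_Diff1_less) simp_all
    ultimately show False using fin(2) by linarith
  qed
  have inj: "inj_on (successor_map s) {1..n}"
  proof (rule inj_onI)
    fix x y assume xy: "x \<in> {1..n}" "y \<in> {1..n}" "successor_map s x = successor_map s y"
    \<comment> \<open>If only \<open>x\<close> is held, the common value is \<open>y\<close>, so the
      unheld \<open>y\<close> would be a successor, contrary to \<open>free\<close>; likewise with
      \<open>x\<close> and \<open>y\<close> interchanged.\<close>
    then show "x = y"
      using free[of x y] free[of y x] consistentD(3)[OF c, of x _ y]
      by (cases "hold s x"; cases "hold s y") (simp_all add: successor_map_def)
  qed
  have maps: "successor_map s ` {1..n} \<subseteq> {1..n}"
  proof (rule image_subsetI)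
    fix x assume "x \<in> {1..n}"
    then show "successor_map s x \<in> {1..n}"
      using held[of x] by (cases "hold s x") (auto simp: successor_map_def)
  qed
  have "successor_map s x = x" if "x \<notin> {1..n}" for x
    using held(1)[of x] that by (cases "hold s x") (auto simp: successor_map_def)
  then show ?thesis
    using endo_inj_surj[OF finite_atLeastAtMost maps inj] inj
    by (intro bij_imp_permutes) (auto simp: bij_betw_def)
qed

text \<open>An unheld agent has by now been rejected by all others, and a held one is with its top
  remaining choice; nothing better is left in either case. This turns preferences into rejections,
  for stability as well as for optimality.\<close>

lemma terminal_rejected:
  assumes c: "consistent s" and t: "unattached n s = {}"
    and i: "i \<in> {1..n}" and p: "prefers L i v (successor_map s i)"
  shows "(i, v) \<in> rejected s"
proof (rule ccontr)
  assume nr: "(i, v) \<notin> rejected s"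
  have v: "v \<in> {1..n}" "v \<noteq> i" using prefers_in[OF i p] prefers_not_self[OF i p] by auto
  show False
  proof (cases "hold s i")
    case None
    then show False using t i v nr by (auto simp: unattached_def predecessors_def remaining_def)
  next
    case (Some x)
    then have "most_preferred L i (remaining n s i) x" using c by (simp add: consistent_def)
    then have "v \<noteq> x \<Longrightarrow> prefers L i x v" using prefers_top[OF i] v nr by blast
    then show False using p Some prefers_asym[OF i] by (auto simp: successor_map_def)
  qed
qed

section \<open>Stability, optimality and uniqueness of the result\<close>

text \<open>If \<open>i\<close> prefers \<open>\<pi> j\<close> to \<open>\<pi> i\<close>, then
  \<open>\<pi> j\<close> has rejected \<open>i\<close> and, by the invariant, holds someone it
  prefers to \<open>i\<close>; injectivity identifies that agent as \<open>j\<close>.\<close>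

lemma execution_result_stable:
  assumes "execution_result n L \<pi>"
  shows "stable_permutation n L \<pi>"
proof -
  from assms obtain s where s: "(proposal_step n L)\<^sup>*\<^sup>* initial_state s" "unattached n s = {}"
    and \<pi>: "\<pi> = successor_map s" by (auto simp: execution_result_def)
  note c = consistent_reachable[OF s(1)]
  have perm: "\<pi> permutes {1..n}" using terminal_permutes[OF c s(2)] \<pi> by simp
  have "prefers L (\<pi> j) j i" if ij: "i \<in> {1..n}" "prefers L i (\<pi> j) (\<pi> i)" for i j
  proof -
    have "(i, \<pi> j) \<in> rejected s" using terminal_rejected[OF c s(2)] ij \<pi> by simp
    then obtain w where w: "hold s w = Some (\<pi> j)" "prefers L (\<pi> j) w i"
      using c unfolding consistent_def by blast
    then have "\<pi> w = \<pi> j" using \<pi> by (simp add: successor_map_def)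
    then have "w = j" using permutes_inj[OF perm] by (auto dest: injD)
    then show ?thesis using w by simp
  qed
  then show ?thesis using perm by (simp add: stable_permutation_def)
qed

text \<open>The condition for \<open>inv \<pi>\<close> at \<open>i\<close> and \<open>j\<close> is
  the contrapositive of the condition for \<open>\<pi>\<close> at \<open>inv \<pi> j\<close> and
  \<open>inv \<pi> i\<close>, with totality and asymmetry handling the negations.\<close>

lemma stable_inv:
  assumes "stable_permutation n L \<pi>"
  shows "stable_permutation n L (inv \<pi>)"
  unfolding stable_permutation_def
proof (intro conjI ballI impI)
  have perm: "\<pi> permutes {1..n}" using assms by (simp add: stable_permutation_def)
  then show pinv: "inv \<pi> permutes {1..n}" by (rule permutes_inv)
  fix i j
  assume i: "i \<in> {1..n}" and j: "j \<in> {1..n}" and p: "prefers L i (inv \<pi> j) (inv \<pi> i)"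
  have in': "inv \<pi> i \<in> {1..n}" "inv \<pi> j \<in> {1..n}"
    using i j by (simp_all only: permutes_in_image[OF pinv])
  show "prefers L (inv \<pi> j) j i"
  proof (rule ccontr)
    assume "\<not> ?thesis"
    moreover have "i \<noteq> j" using p prefers_asym[OF i] by blast
    ultimately have "prefers L (inv \<pi> j) (\<pi> (inv \<pi> i)) (\<pi> (inv \<pi> j))"
      using prefers_total[OF in'(2) i j] by (simp add: permutes_inverses[OF perm])
    then have "prefers L (\<pi> (inv \<pi> i)) (inv \<pi> i) (inv \<pi> j)"
      using assms in' unfolding stable_permutation_def by blast
    then have "prefers L i (inv \<pi> i) (inv \<pi> j)"
      by (simp add: permutes_inverses[OF perm])
    then show False using p prefers_asym[OF i] by blast
  qed
qed

lemma execution_result_best: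
  assumes e: "execution_result n L \<pi>" and st: "stable_permutation n L \<pi>'"
    and i: "i \<in> {1..n}" and ne: "\<pi>' i \<noteq> \<pi> i"
  shows "prefers L i (\<pi> i) (\<pi>' i)"
proof (rule ccontr)
  assume "\<not> ?thesis"
  then have p: "prefers L i (\<pi>' i) (\<pi> i)"
    using prefers_total[OF i stable_in[OF st i] stable_in[OF execution_result_stable[OF e] i] ne]
    by blast
  from e obtain s where s: "(proposal_step n L)\<^sup>*\<^sup>* initial_state s" "unattached n s = {}"
    and \<pi>: "\<pi> = successor_map s" by (auto simp: execution_result_def)
  have "(i, \<pi>' i) \<in> rejected s"
    using terminal_rejected[OF consistent_reachable[OF s(1)] s(2) i] p \<pi> by simp
  then show False using rejected_not_stable_successor[OF s(1) st] by blast
qed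

text \<open>The agent \<open>inv \<pi> i\<close> has \<open>i\<close> as its best stable successor,
  so it prefers \<open>i\<close> to its different successor under \<open>\<pi>'\<close>. Stability
  of \<open>\<pi>'\<close> then forces \<open>i\<close> to prefer its own predecessor
  \<open>inv \<pi>' i\<close> to \<open>inv \<pi> i\<close>.\<close>

lemma execution_result_worst:
  assumes e: "execution_result n L \<pi>" and st: "stable_permutation n L \<pi>'"
    and i: "i \<in> {1..n}" and ne: "inv \<pi>' i \<noteq> inv \<pi> i"
  shows "prefers L i (inv \<pi>' i) (inv \<pi> i)"
proof -
  note st0 = execution_result_stable[OF e]
  have perm: "\<pi> permutes {1..n}" and perm': "\<pi>' permutes {1..n}"
    using st st0 by (simp_all add: stable_permutation_def)
  have in': "inv \<pi> i \<in> {1..n}" "inv \<pi>' i \<in> {1..n}"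
    using stable_in[OF stable_inv[OF st0] i] stable_in[OF stable_inv[OF st] i] by simp_all
  have "\<pi>' (inv \<pi> i) \<noteq> \<pi> (inv \<pi> i)"
    using ne permutes_inverses[OF perm] permutes_inverses[OF perm'] by metis
  then have "prefers L (inv \<pi> i) (\<pi> (inv \<pi> i)) (\<pi>' (inv \<pi> i))"
    using execution_result_best[OF e st in'(1)] by blast
  \<comment> \<open>Writing \<open>i\<close> as \<open>\<pi>' (inv \<pi>' i)\<close> gives the
    premise of the stability condition for \<open>\<pi>'\<close>.\<close>
  then have "prefers L (inv \<pi> i) (\<pi>' (inv \<pi>' i)) (\<pi>' (inv \<pi> i))"
    by (simp add: permutes_inverses[OF perm] permutes_inverses[OF perm'])
  then have "prefers L (\<pi>' (inv \<pi>' i)) (inv \<pi>' i) (inv \<pi> i)"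
    using st in' unfolding stable_permutation_def by blast
  then show ?thesis by (simp add: permutes_inverses[OF perm'])
qed

lemma execution_result_unique:
  assumes "execution_result n L \<pi>" "execution_result n L \<pi>'"
  shows "\<pi> = \<pi>'"
proof
  fix i
  note st = assms[THEN execution_result_stable]
  show "\<pi> i = \<pi>' i"
  proof (cases "i \<in> {1..n}")
    case True
    then show ?thesis
      using execution_result_best[OF assms(1) st(2) True] execution_result_best[OF assms(2) st(1) True]
        prefers_asym[OF True] by metis
  next
    case False
    then show ?thesis using st unfolding stable_permutation_def permutes_def by metis
  qed
qed

section \<open>Termination\<close>

text \<open>Acceptance adds a hold; exchange and rejection add a rejected pair and preserve the
  number of holds. Hence the sum grows by exactly one at each step.\<close>

definition progress :: "state \<Rightarrow> nat" where
  "progress s = card (rejected s) + card (dom (hold s))"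

lemma consistent_finite:
  assumes "consistent s"
  shows "rejected s \<subseteq> {1..n} \<times> {1..n}" "dom (hold s) \<subseteq> {1..n}"
    "finite (rejected s)" "finite (dom (hold s))"
proof -
  show *: "rejected s \<subseteq> {1..n} \<times> {1..n}"
    using consistentD(4,5)[OF assms] by (intro subrelI SigmaI) simp_all
  show **: "dom (hold s) \<subseteq> {1..n}"
    using consistentD(1)[OF assms] by blast
  show "finite (rejected s)" "finite (dom (hold s))"
    by (rule finite_subset[OF *], simp, rule finite_subset[OF **], simp)
qed

lemma progress_le: "consistent s \<Longrightarrow> progress s \<le> n * n + n"
  using card_mono[OF _ consistent_finite(1)] card_mono[OF _ consistent_finite(2)]
  unfolding progress_def by (intro add_mono) fastforce+

lemma progress_step:
  assumes "proposal_step n L s s'" "consistent s"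
  shows "progress s' = Suc (progress s)"
  using assms
proof (induction rule: proposal_step.induct)
  case (accept u s v)
  then show ?case using unattachedD[OF accept(1)] consistent_finite[OF accept(4)]
    by (auto simp: progress_def card_insert_if)
next
  case (exchange u s v w)
  note h = unattachedD[OF exchange(1)] and fin = consistent_finite[OF exchange(5)]
  \<comment> \<open>The pair is new: by the invariant the holder \<open>v\<close> is still among the
    remaining agents of \<open>w\<close>.\<close>
  have "(w, v) \<notin> rejected s"
    using exchange(3,5) remainingD unfolding consistent_def by blast
  moreover have "dom ((hold s)(w := None, u \<mapsto> v)) = insert u (dom (hold s) - {w})" by auto
  moreover have "w \<in> dom (hold s)" "u \<notin> dom (hold s)" using h exchange(3) by auto
  then have "card (insert u (dom (hold s) - {w})) = card (dom (hold s))"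
    using fin(4) card_Suc_Diff1[of "dom (hold s)" w] by (simp add: card_insert_if)
  ultimately show ?case using fin(3) by (simp add: progress_def)
next
  case (reject u s v w)
  then show ?case using remainingD[OF reject(2)] consistent_finite(3)[OF reject(5)]
    by (simp add: progress_def)
qed

lemma no_infinite_execution: "\<not> infinite_execution n L \<sigma>"
proof
  assume inf: "infinite_execution n L \<sigma>"
  have "consistent (\<sigma> k) \<and> k \<le> progress (\<sigma> k)" for k
  proof (induction k)
    case 0
    then show ?case using inf consistent_initial by (simp add: infinite_execution_def)
  next
    case (Suc k)
    have "proposal_step n L (\<sigma> k) (\<sigma> (Suc k))" using inf by (simp add: infinite_execution_def)
    then show ?case using Suc consistent_step progress_step by auto
  qed
  from this[of "Suc (n * n + n)"] show False using progress_le by fastforce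
qed

lemma step_exists:
  assumes "unattached n s \<noteq> {}"
  shows "\<exists>s'. proposal_step n L s s'"
proof -
  from assms obtain u where u: "u \<in> unattached n s" by blast
  then have "u \<in> {1..n}" "remaining n s u \<subseteq> {1..n}" "remaining n s u \<noteq> {}"
    by (auto simp: unattached_def remaining_def)
  then obtain v where v: "most_preferred L u (remaining n s u) v"
    using most_preferred_exists by blast
  show ?thesis
  proof (cases "v \<in> successors s")
    case True
    then obtain w where "hold s w = Some v" by (auto simp: successors_def ran_def)
    then show ?thesis using proposal_step.exchange[OF u v] proposal_step.reject[OF u v] by blast
  next
    case False
    then show ?thesis using proposal_step.accept[OF u v] by blast
  qed
qed

lemma execution_result_exists: "\<exists>\<pi>. execution_result n L \<pi>"
proof -
  have "\<exists>s'. (proposal_step n L)\<^sup>*\<^sup>* s s' \<and> unattached n s' = {}" if "consistent s" for s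
    using that
  proof (induction "n * n + n - progress s" arbitrary: s rule: less_induct)
    case less
    show ?case
    proof (cases "unattached n s = {}")
      case False
      then obtain s' where s': "proposal_step n L s s'" using step_exists by blast
      have c: "consistent s'" using consistent_step s' less by blast
      \<comment> \<open>The bound is applied to \<open>s'\<close>, so \<open>progress s\<close> lies
        strictly below it and truncated subtraction really decreases.\<close>
      then have "n * n + n - progress s' < n * n + n - progress s"
        using progress_step[OF s' less(2)] progress_le[OF c] by simp
      then show ?thesis using less(1) c s' by (meson converse_rtranclp_into_rtranclp)
    qed auto
  qed
  then show ?thesis using consistent_initial unfolding execution_result_def by blast
qed

section \<open>Matched pairs and fixed points of stable permutations\<close>

lemma inv_eq_iff: "stable_permutation n L \<pi> \<Longrightarrow> inv \<pi> i = j \<longleftrightarrow> \<pi> j = i"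
  unfolding stable_permutation_def by (metis permutes_inverses)

text \<open>The stable permutation \<open>inv \<pi>\<close> gives \<open>i\<close> a successor no better than \<open>j\<close>, while \<open>j\<close> is the worst
  predecessor of \<open>i\<close>.\<close>

lemma matched_in_stable:
  assumes e: "execution_result n L \<pi>\<^sub>0" and st: "stable_permutation n L \<pi>"
    and i: "i \<in> {1..n}" and ij: "\<pi>\<^sub>0 i = j" "\<pi>\<^sub>0 j = i"
  shows "\<pi> j = i"
proof (rule ccontr)
  assume ne: "\<pi> j \<noteq> i"
  then have ne': "inv \<pi> i \<noteq> j" using inv_eq_iff[OF st] by simp
  have "inv \<pi>\<^sub>0 i = j" using inv_eq_iff[OF execution_result_stable[OF e]] ij by simp
  then show False
    using execution_result_worst[OF e st i] execution_result_best[OF e stable_inv[OF st] i]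
      ne' ij prefers_asym[OF i] by auto
qed

text \<open>Two agents without partners would prefer each other to staying alone; stability would
  then make \<open>j\<close> prefer itself to \<open>i\<close>, but \<open>j\<close> is last on its
  own list.\<close>

lemma stable_fixed_point_unique:
  assumes "stable_permutation n L \<pi>" "i \<in> {1..n}" "j \<in> {1..n}" "\<pi> i = i" "\<pi> j = j"
  shows "i = j"
proof (rule ccontr)
  assume "i \<noteq> j"
  then have "prefers L i (\<pi> j) (\<pi> i)" using assms prefers_self by simp
  then have "prefers L (\<pi> j) j i" using assms(1-3) unfolding stable_permutation_def by blast
  then show False using assms prefers_not_self by metis
qed

text \<open>As \<open>i\<close> is last on its own list, its worst predecessor
  \<open>inv \<pi>\<^sub>0 i\<close> must be \<open>i\<close> once some stable permutation fixes
  \<open>i\<close>. So its best successor \<open>\<pi>\<^sub>0 i\<close> is \<open>i\<close> too,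
  leaving no other stable successor.\<close>

lemma stable_fixed_point_shared:
  assumes st: "stable_permutation n L \<pi>" "stable_permutation n L \<pi>'"
    and i: "i \<in> {1..n}" and fp: "\<pi> i = i"
  shows "\<pi>' i = i"
proof -
  obtain \<pi>\<^sub>0 where e: "execution_result n L \<pi>\<^sub>0" using execution_result_exists ..
  have "inv \<pi> i = i" using fp inv_eq_iff[OF st(1)] by simp
  then have "inv \<pi>\<^sub>0 i = i"
    using execution_result_worst[OF e st(1) i] prefers_not_self[OF i] by metis
  then have "\<pi>\<^sub>0 i = i" using inv_eq_iff[OF execution_result_stable[OF e]] by simp
  then show ?thesis
    using execution_result_best[OF e st(2) i] prefers_not_self[OF i] by metis
qed

end

theorem theorem1p1:
  fixes n :: nat and L :: "nat \<Rightarrow> nat list"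
  assumes "preference_lists n L"
  shows
    "(\<nexists>\<sigma>. infinite_execution n L \<sigma>) \<and>
     (\<forall>\<pi>. execution_result n L \<pi> \<longrightarrow>
        \<pi> permutes {1..n} \<and>
        (\<forall>i\<in>{1..n}. \<forall>j\<in>{1..n}.
           prefers L i (\<pi> j) (\<pi> i) \<longrightarrow> prefers L (\<pi> j) j i)) \<and>
     (\<forall>\<pi>. stable_permutation n L \<pi> \<longrightarrow> stable_permutation n L (inv \<pi>)) \<and>
     (\<forall>\<pi>. execution_result n L \<pi> \<longrightarrow>
        (\<forall>i\<in>{1..n}.
           most_preferred L i {\<pi>' i |\<pi>'. stable_permutation n L \<pi>'} (\<pi> i) \<and>
           least_preferred L i {inv \<pi>' i |\<pi>'. stable_permutation n L \<pi>'} (inv \<pi> i))) \<and>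
     (\<exists>\<pi>\<^sub>0. {\<pi>. execution_result n L \<pi>} = {\<pi>\<^sub>0} \<and> stable_permutation n L \<pi>\<^sub>0 \<and>
        (\<forall>i\<in>{1..n}. prefers L i (\<pi>\<^sub>0 i) (inv \<pi>\<^sub>0 i) \<or> \<pi>\<^sub>0 i = inv \<pi>\<^sub>0 i) \<and>
        (\<forall>i\<in>{1..n}. \<forall>j\<in>{1..n}. i \<noteq> j \<and> \<pi>\<^sub>0 i = j \<and> \<pi>\<^sub>0 j = i \<longrightarrow>
           (\<forall>\<pi>. stable_permutation n L \<pi> \<longrightarrow> \<pi> i = j \<and> \<pi> j = i))) \<and>
     ((\<forall>\<pi>. stable_permutation n L \<pi> \<longrightarrow> (\<forall>i\<in>{1..n}. \<pi> i \<noteq> i)) \<or>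
      (\<exists>i\<in>{1..n}. \<forall>\<pi>. stable_permutation n L \<pi> \<longrightarrow> {j \<in> {1..n}. \<pi> j = j} = {i}))"
proof -
  interpret preferences n L by unfold_locales (fact assms)
  obtain \<pi>\<^sub>0 where e: "execution_result n L \<pi>\<^sub>0" using execution_result_exists ..
  note st = execution_result_stable[OF e]
  have best: "most_preferred L i {\<pi>' i |\<pi>'. stable_permutation n L \<pi>'} (\<pi> i)"
    if "execution_result n L \<pi>" "i \<in> {1..n}" for \<pi> i
    using that execution_result_stable execution_result_best unfolding most_preferred_def by blast
  have worst: "least_preferred L i {inv \<pi>' i |\<pi>'. stable_permutation n L \<pi>'} (inv \<pi> i)"
    if "execution_result n L \<pi>" "i \<in> {1..n}" for \<pi> i
    using that execution_result_stable execution_result_worst unfolding least_preferred_def by blast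
  have unique: "{\<pi>. execution_result n L \<pi>} = {\<pi>\<^sub>0}"
    using e execution_result_unique by blast
  \<comment> \<open>The inverse of \<open>\<pi>\<^sub>0\<close> is stable, so the predecessor of
    \<open>i\<close> competes as a successor against the best one.\<close>
  have succ_pred: "\<forall>i\<in>{1..n}. prefers L i (\<pi>\<^sub>0 i) (inv \<pi>\<^sub>0 i) \<or> \<pi>\<^sub>0 i = inv \<pi>\<^sub>0 i"
    using execution_result_best[OF e stable_inv[OF st]] by metis
  \<comment> \<open>Both equations come from \<open>matched_in_stable\<close>, used for
    \<open>i\<close>, \<open>j\<close> and again with the two interchanged.\<close>
  have matched: "\<forall>i\<in>{1..n}. \<forall>j\<in>{1..n}. i \<noteq> j \<and> \<pi>\<^sub>0 i = j \<and> \<pi>\<^sub>0 j = i \<longrightarrow>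
      (\<forall>\<pi>. stable_permutation n L \<pi> \<longrightarrow> \<pi> i = j \<and> \<pi> j = i)"
    using matched_in_stable[OF e] by blast
  have fixed: "(\<forall>\<pi>. stable_permutation n L \<pi> \<longrightarrow> (\<forall>i\<in>{1..n}. \<pi> i \<noteq> i)) \<or>
      (\<exists>i\<in>{1..n}. \<forall>\<pi>. stable_permutation n L \<pi> \<longrightarrow> {j \<in> {1..n}. \<pi> j = j} = {i})"
  proof (rule disjCI)
    assume *: "\<not> (\<exists>i\<in>{1..n}. \<forall>\<pi>. stable_permutation n L \<pi> \<longrightarrow> {j \<in> {1..n}. \<pi> j = j} = {i})"
    show "\<forall>\<pi>. stable_permutation n L \<pi> \<longrightarrow> (\<forall>i\<in>{1..n}. \<pi> i \<noteq> i)"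
    proof (intro allI impI ballI notI)
      fix \<pi> i
      assume \<pi>: "stable_permutation n L \<pi>" and i: "i \<in> {1..n}" and "\<pi> i = i"
      then have "\<pi>' i = i" if "stable_permutation n L \<pi>'" for \<pi>'
        using stable_fixed_point_shared that by blast
      then have "{j \<in> {1..n}. \<pi>' j = j} = {i}" if "stable_permutation n L \<pi>'" for \<pi>'
        using stable_fixed_point_unique[OF that] that i by blast
      then show False using * i by blast
    qed
  qed
  have stable: "\<forall>\<pi>. execution_result n L \<pi> \<longrightarrow> \<pi> permutes {1..n} \<and>
      (\<forall>i\<in>{1..n}. \<forall>j\<in>{1..n}. prefers L i (\<pi> j) (\<pi> i) \<longrightarrow> prefers L (\<pi> j) j i)"
    using execution_result_stable unfolding stable_permutation_def by blast
  show ?thesis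
    apply (intro conjI)
    subgoal using no_infinite_execution by blast
    subgoal by (fact stable)
    subgoal using stable_inv by blast
    subgoal using best worst by blast
    subgoal using unique st succ_pred matched by (intro exI[of _ \<pi>\<^sub>0] conjI)
    subgoal by (fact fixed)
    done
qed

end
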